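(* For every integer $N$ there exists a PL $3$-sphere $\mathsf{K}$ with $n\geq N$ vertices such that $\tau(\mathcal{F}(\mathsf{K}))\geq \frac{11}{21}n$.
   Context: A simplicial complex is a PL $d$-sphere if it is PL homeomorphic to the boundary complex of an abstract $(d+1)$-simplex. For a simplicial complex $\mathsf{K}$, the facet hypergraph $\mathcal{F}(\mathsf{K})$ is the hypergraph on the vertex set of $\mathsf{K}$ whose hyperedges are the facets (inclusion-maximal faces) of $\mathsf{K}$. A transversal of a hypergraph $\mathcal{H}$ is a vertex set meeting every hyperedge, and $\tau(\mathcal{H})$ is the minimum size of a transversal. *)

theory Defs
  imports Complex_Main
begin

definition simplicial_complex :: "'a set set \<Rightarrow> bool" where
  "simplicial_complex K \<longleftrightarrow> finite K \<and> K \<noteq> {} \<and> (\<forall>s\<in>K. finite s) \<and>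
     (\<forall>s\<in>K. \<forall>t. t \<subseteq> s \<longrightarrow> t \<in> K)"

definition vertices :: "'a set set \<Rightarrow> 'a set" where
  "vertices K = \<Union>K"

definition link :: "'a set set \<Rightarrow> 'a set \<Rightarrow> 'a set set" where
  "link K s = {t \<in> K. t \<inter> s = {} \<and> t \<union> s \<in> K}"

text \<open>Stellar subdivision of K at the nonempty face s, with new vertex v:
  (K minus the open star of s) union (v * boundary(s) * link(s)).\<close>

definition stellar_subdivision :: "'a set set \<Rightarrow> 'a set \<Rightarrow> 'a \<Rightarrow> 'a set set" where
  "stellar_subdivision K s v =
     {t \<in> K. \<not> s \<subseteq> t} \<union> {insert v (a \<union> b) | a b. a \<subset> s \<and> b \<in> link K s}"

definition stellar_step :: "'a set set \<Rightarrow> 'a set set \<Rightarrow> bool" where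
  "stellar_step K L \<longleftrightarrow> simplicial_complex K \<and>
     (\<exists>s v. s \<in> K \<and> s \<noteq> {} \<and> v \<notin> vertices K \<and> L = stellar_subdivision K s v)"

definition complex_iso :: "'a set set \<Rightarrow> 'a set set \<Rightarrow> bool" where
  "complex_iso K L \<longleftrightarrow> simplicial_complex K \<and>
     (\<exists>f. inj_on f (vertices K) \<and> L = (\<lambda>t. f ` t) ` K)"

text \<open>PL homeomorphism of complexes in the combinatorial sense (Alexander--Newman):
  related by a finite sequence of stellar subdivisions, their inverses (stellar welds)
  and simplicial isomorphisms.\<close>

definition PL_homeomorphic :: "'a set set \<Rightarrow> 'a set set \<Rightarrow> bool" where
  "PL_homeomorphic K L \<longleftrightarrow>
     (\<lambda>A B. stellar_step A B \<or> stellar_step B A \<or> complex_iso A B \<or> complex_iso B A)\<^sup>*\<^sup>* K L"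

definition simplex_boundary :: "'a set \<Rightarrow> 'a set set" where
  "simplex_boundary S = {t. t \<subset> S}"

definition PL_sphere :: "nat \<Rightarrow> 'a set set \<Rightarrow> bool" where
  "PL_sphere d K \<longleftrightarrow> simplicial_complex K \<and>
     (\<exists>S. finite S \<and> card S = d + 2 \<and> PL_homeomorphic K (simplex_boundary S))"

definition facets :: "'a set set \<Rightarrow> 'a set set" where
  "facets K = {s \<in> K. \<forall>t\<in>K. s \<subseteq> t \<longrightarrow> t = s}"

definition transversal :: "'a set \<Rightarrow> 'a set set \<Rightarrow> 'a set \<Rightarrow> bool" where
  "transversal V H T \<longleftrightarrow> T \<subseteq> V \<and> (\<forall>e\<in>H. T \<inter> e \<noteq> {})"

definition transversal_number :: "'a set \<Rightarrow> 'a set set \<Rightarrow> nat" where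
  "transversal_number V H = (LEAST k. \<exists>T. transversal V H T \<and> card T = k)"

definition tau_facets :: "'a set set \<Rightarrow> nat" where
  "tau_facets K = transversal_number (vertices K) (facets K)"

end

theory Submission
  imports Defs
begin

text \<open>
  There is a triangulated 3-ball, the block, whose boundary is the boundary of a tetrahedron and whose
  17 interior vertices span enough facets that every transversal contains at least 9 of them.
  The block arises from the tetrahedron by bistellar flips in the interior, and each flip is a stellar
  subdivision followed by a weld. Replacing a facet of a PL 3-sphere by the block therefore gives a
  PL 3-sphere with 17 more vertices and a transversal bound larger by 9, provided the replaced facet
  played no role in the old bound; a facet of the block touching its boundary can be replaced next.
  Starting from the boundary of the 4-simplex, \<open>m\<close> insertions give \<open>5 + 17 m\<close> vertices and
  \<open>\<tau> \<ge> 9 m\<close>. As \<open>9 / 17 > 11 / 21\<close>, this suffices once \<open>m \<ge> 28\<close>.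
\<close>

section \<open>Bistellar flips\<close>

text \<open>Complexes are handled through their facets, so that a flip only edits a set of
  facets.\<close>

definition generated_complex :: "'a set set \<Rightarrow> 'a set set" where
  "generated_complex F = {t. \<exists>f\<in>F. t \<subseteq> f}"

text \<open>The bistellar move, on facets: the join of \<open>s\<close> with the boundary of
  \<open>t\<close> gives way to the join of the boundary of \<open>s\<close> with
  \<open>t\<close>.\<close>

definition flip :: "'a set set \<Rightarrow> 'a set \<Rightarrow> 'a set \<Rightarrow> 'a set set" where
  "flip F s t = {f \<in> F. \<not> s \<subseteq> f} \<union> (\<lambda>x. (s - {x}) \<union> t) ` s"

text \<open>The condition on the facets through \<open>s\<close> makes the boundary of
  \<open>t\<close> the link of \<open>s\<close>; the last one says that \<open>t\<close> is not yet
  a face. A singleton \<open>t\<close> gives the starring of a facet \<open>s\<close> at a new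
  vertex.\<close>

definition flippable :: "'a set set \<Rightarrow> 'a set \<Rightarrow> 'a set \<Rightarrow> bool" where
  "flippable F s t \<longleftrightarrow> s \<noteq> {} \<and> t \<noteq> {} \<and> s \<inter> t = {} \<and>
     {f \<in> F. s \<subseteq> f} = (\<lambda>x. s \<union> (t - {x})) ` t \<and> (\<forall>f\<in>F. \<not> t \<subseteq> f)"

lemma simplicial_complex_generated:
  assumes "finite F" "F \<noteq> {}" "\<And>f. f \<in> F \<Longrightarrow> finite f"
  shows "simplicial_complex (generated_complex F)"
proof -
  have "generated_complex F = (\<Union>f\<in>F. Pow f)"
    by (auto simp: generated_complex_def)
  then have "finite (generated_complex F)"
    using assms by simp
  moreover have "generated_complex F \<noteq> {}"
    using assms(2) by (auto simp: generated_complex_def)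
  moreover have "finite t" if "t \<in> generated_complex F" for t
    using that assms(3) finite_subset unfolding generated_complex_def by blast
  moreover have "u \<in> generated_complex F" if "t \<in> generated_complex F" "u \<subseteq> t" for t u
    using that unfolding generated_complex_def by blast
  ultimately show ?thesis
    unfolding simplicial_complex_def by blast
qed

lemma vertices_generated: "vertices (generated_complex F) = \<Union>F"
  by (auto simp: vertices_def generated_complex_def)

text \<open>Sets of equal finite size form an antichain, so none of them is absorbed by
  another.\<close>

lemma facets_generated:
  assumes "\<And>f. f \<in> F \<Longrightarrow> finite f \<and> card f = n"
  shows "facets (generated_complex F) = F"
proof -
  have eq: "f = g" if "f \<in> F" "g \<in> F" "f \<subseteq> g" for f g
    using assms that by (metis card_subset_eq)
  show ?thesis
  proof (intro set_eqI iffI)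
    fix f assume f: "f \<in> facets (generated_complex F)"
    then obtain g where g: "g \<in> F" "f \<subseteq> g"
      by (auto simp: facets_def generated_complex_def)
    moreover from g have "g \<in> generated_complex F"
      by (auto simp: generated_complex_def)
    ultimately show "f \<in> F"
      using f by (auto simp: facets_def)
  next
    fix f assume f: "f \<in> F"
    then show "f \<in> facets (generated_complex F)"
      using eq unfolding facets_def generated_complex_def by blast
  qed
qed

section \<open>Links of the two exchanged faces\<close>

lemma flippable_facetE:
  assumes "flippable F s t" "f \<in> F" "s \<subseteq> f"
  obtains x where "x \<in> t" "f = s \<union> (t - {x})"
proof -
  have "f \<in> {f \<in> F. s \<subseteq> f}"
    using assms(2,3) by simp
  then show thesis
    using assms(1) that unfolding flippable_def by (metis (no_types, lifting) imageE)
qed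

lemma flippable_facetI:
  assumes "flippable F s t" "x \<in> t"
  shows "s \<union> (t - {x}) \<in> F"
proof -
  have "s \<union> (t - {x}) \<in> {f \<in> F. s \<subseteq> f}"
    using assms unfolding flippable_def by (metis (no_types, lifting) imageI)
  then show ?thesis
    by simp
qed

lemma link_generated:
  assumes "flippable F s t"
  shows "link (generated_complex F) s = {b. b \<subset> t}"
proof (intro set_eqI iffI)
  fix b assume b: "b \<in> link (generated_complex F) s"
  then obtain f where f: "f \<in> F" "b \<union> s \<subseteq> f" and disj: "b \<inter> s = {}"
    by (auto simp: link_def generated_complex_def)
  then obtain x where "x \<in> t" "f = s \<union> (t - {x})"
    using flippable_facetE[OF assms] by auto
  then show "b \<in> {b. b \<subset> t}"
    using f disj by auto
next
  fix b assume "b \<in> {b. b \<subset> t}"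
  then obtain x where x: "x \<in> t" "b \<subseteq> t - {x}"
    by auto
  then have "s \<union> (t - {x}) \<in> F"
    using flippable_facetI[OF assms] by simp
  moreover have "b \<inter> s = {}" "b \<subseteq> s \<union> (t - {x})" "b \<union> s \<subseteq> s \<union> (t - {x})"
    using x assms by (auto simp: flippable_def)
  ultimately show "b \<in> link (generated_complex F) s"
    unfolding link_def generated_complex_def by auto
qed

text \<open>A face of a new facet that misses \<open>y\<close> in \<open>t\<close> lies in the old
  facet \<open>s \<union> (t - {y})\<close>, and symmetrically with \<open>s\<close> and
  \<open>t\<close> exchanged. Hence the two complexes differ only in faces containing
  \<open>s\<close> or \<open>t\<close>.\<close>

lemma generated_flip_without:
  assumes "flippable F s t"
  shows "{u \<in> generated_complex (flip F s t). \<not> t \<subseteq> u} = {u \<in> generated_complex F. \<not> s \<subseteq> u}"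
proof (intro set_eqI iffI)
  fix u assume "u \<in> {u \<in> generated_complex (flip F s t). \<not> t \<subseteq> u}"
  then obtain f where f: "f \<in> flip F s t" "u \<subseteq> f" "\<not> t \<subseteq> u"
    by (auto simp: generated_complex_def)
  show "u \<in> {u \<in> generated_complex F. \<not> s \<subseteq> u}"
  proof (cases "f \<in> F \<and> \<not> s \<subseteq> f")
    case True
    then show ?thesis
      using f by (auto simp: generated_complex_def)
  next
    case False
    then obtain x where x: "x \<in> s" "f = (s - {x}) \<union> t"
      using f(1) by (auto simp: flip_def)
    obtain y where y: "y \<in> t" "y \<notin> u"
      using f(3) by auto
    have "s \<union> (t - {y}) \<in> F" "x \<notin> t"
      using flippable_facetI[OF assms y(1)] assms x(1) by (auto simp: flippable_def)
    moreover have "u \<subseteq> s \<union> (t - {y})" "x \<notin> u"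
      using x(2) y(2) f(2) \<open>x \<notin> t\<close> by auto
    ultimately show ?thesis
      using x(1) by (auto simp: generated_complex_def)
  qed
next
  fix u assume "u \<in> {u \<in> generated_complex F. \<not> s \<subseteq> u}"
  then obtain f x where f: "f \<in> F" "u \<subseteq> f" "x \<in> s" "x \<notin> u"
    by (auto simp: generated_complex_def)
  have "\<not> t \<subseteq> f"
    using assms f(1) by (simp add: flippable_def)
  then have nt: "\<not> t \<subseteq> u"
    using f(2) by auto
  show "u \<in> {u \<in> generated_complex (flip F s t). \<not> t \<subseteq> u}"
  proof (cases "s \<subseteq> f")
    case True
    then obtain y where "y \<in> t" "f = s \<union> (t - {y})"
      using flippable_facetE[OF assms f(1)] by auto
    then have "u \<subseteq> (s - {x}) \<union> t"
      using f by auto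
    then show ?thesis
      using f(3) nt by (auto simp: generated_complex_def flip_def)
  next
    case False
    then show ?thesis
      using f nt by (auto simp: generated_complex_def flip_def)
  qed
qed

lemma link_generated_flip:
  assumes "flippable F s t"
  shows "link (generated_complex (flip F s t)) t = {a. a \<subset> s}"
proof (intro set_eqI iffI)
  fix a assume "a \<in> link (generated_complex (flip F s t)) t"
  then obtain f where f: "f \<in> flip F s t" "a \<union> t \<subseteq> f" "a \<inter> t = {}"
    by (auto simp: link_def generated_complex_def)
  then have "f \<in> (\<lambda>x. (s - {x}) \<union> t) ` s"
    using assms by (auto simp: flip_def flippable_def)
  then show "a \<in> {a. a \<subset> s}"
    using f by auto
next
  fix a assume "a \<in> {a. a \<subset> s}"
  then obtain x where x: "x \<in> s" "a \<subseteq> s - {x}"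
    by auto
  then have "(s - {x}) \<union> t \<in> flip F s t"
    by (auto simp: flip_def)
  moreover have "a \<inter> t = {}" "a \<subseteq> (s - {x}) \<union> t" "a \<union> t \<subseteq> (s - {x}) \<union> t"
    using x assms by (auto simp: flippable_def)
  ultimately show "a \<in> link (generated_complex (flip F s t)) t"
    unfolding link_def generated_complex_def by auto
qed

text \<open>Starring the face that disappears and starring the face that is created give the same
  complex, so a flip is a stellar subdivision followed by a weld.\<close>

lemma flip_common_subdivision:
  assumes "flippable F s t"
  shows "stellar_subdivision (generated_complex (flip F s t)) t v =
    stellar_subdivision (generated_complex F) s v"
proof -
  have "{insert v (a \<union> b) |a b. a \<subset> t \<and> b \<in> {a. a \<subset> s}} =
      {insert v (a \<union> b) |a b. a \<subset> s \<and> b \<in> {b. b \<subset> t}}"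
    by (rule Collect_cong) (metis Un_commute mem_Collect_eq)
  then show ?thesis
    unfolding stellar_subdivision_def link_generated[OF assms] link_generated_flip[OF assms]
      generated_flip_without[OF assms] by simp
qed

lemma PL_homeomorphic_flip:
  fixes F :: "nat set set"
  assumes fl: "flippable F s t" and fin: "finite F" "\<And>f. f \<in> F \<Longrightarrow> finite f"
  shows "PL_homeomorphic (generated_complex (flip F s t)) (generated_complex F)"
proof -
  obtain x y where xy: "x \<in> s" "y \<in> t"
    using fl by (auto simp: flippable_def)
  have st: "s \<union> (t - {y}) \<in> F"
    using flippable_facetI[OF fl xy(2)] .
  then have fin_st: "finite s" "finite t"
    using fin(2) by (metis finite_Un finite_Diff2 finite.emptyI finite_insert)+
  have fin': "finite (flip F s t)" "\<And>f. f \<in> flip F s t \<Longrightarrow> finite f"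
    using fin fin_st by (auto simp: flip_def)
  have ne: "F \<noteq> {}" "flip F s t \<noteq> {}"
    using st xy by (auto simp: flip_def)
  \<comment> \<open>The same \<open>v\<close> stars both complexes, so it has to be new to
    both.\<close>
  have "finite (\<Union>F \<union> \<Union>(flip F s t))"
    using fin fin' by auto
  then obtain v where v: "v \<notin> \<Union>F \<union> \<Union>(flip F s t)"
    using ex_new_if_finite[OF infinite_UNIV_nat] by blast
  let ?S = "stellar_subdivision (generated_complex F) s v"
  have "s \<in> generated_complex F" "t \<in> generated_complex (flip F s t)" "s \<noteq> {}" "t \<noteq> {}"
    using st xy by (auto simp: generated_complex_def flip_def)
  then have steps: "stellar_step (generated_complex F) ?S"
    "stellar_step (generated_complex (flip F s t)) ?S"
    using v simplicial_complex_generated[OF fin(1) ne(1) fin(2)]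
      simplicial_complex_generated[OF fin'(1) ne(2) fin'(2)] flip_common_subdivision[OF fl, of v]
    unfolding stellar_step_def vertices_generated by blast+
  show ?thesis
    unfolding PL_homeomorphic_def
    by (rule converse_rtranclp_into_rtranclp[where b = ?S, OF _ r_into_rtranclp]) (simp_all add: steps)
qed

section \<open>Flips under renaming and inside larger complexes\<close>

lemma flippable_image:
  assumes "inj h" "flippable F s t"
  shows "flippable ((`) h ` F) (h ` s) (h ` t)"
proof -
  have sub: "h ` a \<subseteq> h ` b \<longleftrightarrow> a \<subseteq> b" for a b
    using assms(1) by (rule inj_image_subset_iff)
  have "{f \<in> (`) h ` F. h ` s \<subseteq> f} = (`) h ` {f \<in> F. h ` s \<subseteq> h ` f}"
    by blast
  also have "\<dots> = (`) h ` {f \<in> F. s \<subseteq> f}"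
    by (simp only: sub)
  also have "\<dots> = (`) h ` (\<lambda>x. s \<union> (t - {x})) ` t"
    using assms(2) by (simp add: flippable_def)
  also have "\<dots> = (\<lambda>x. h ` s \<union> (h ` t - {x})) ` h ` t"
    unfolding image_image image_Un image_set_diff[OF assms(1)] by simp
  finally have "{f \<in> (`) h ` F. h ` s \<subseteq> f} = (\<lambda>x. h ` s \<union> (h ` t - {x})) ` h ` t" .
  moreover have "\<forall>f\<in>(`) h ` F. \<not> h ` t \<subseteq> f"
    using assms(2) by (simp add: sub flippable_def)
  moreover have "h ` s \<inter> h ` t = {}"
    using assms(2) by (simp add: image_Int[OF assms(1), symmetric] flippable_def)
  ultimately show ?thesis
    using assms(2) by (simp add: flippable_def)
qed

lemma flip_image:
  assumes "inj h"
  shows "flip ((`) h ` F) (h ` s) (h ` t) = (`) h ` flip F s t"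
proof -
  have sub: "h ` a \<subseteq> h ` b \<longleftrightarrow> a \<subseteq> b" for a b
    using assms(1) by (rule inj_image_subset_iff)
  have "{f \<in> (`) h ` F. \<not> h ` s \<subseteq> f} = (`) h ` {f \<in> F. \<not> h ` s \<subseteq> h ` f}"
    by blast
  also have "\<dots> = (`) h ` {f \<in> F. \<not> s \<subseteq> f}"
    by (simp only: sub)
  finally have "{f \<in> (`) h ` F. \<not> h ` s \<subseteq> f} = (`) h ` {f \<in> F. \<not> s \<subseteq> f}" .
  moreover have "(\<lambda>x. (h ` s - {x}) \<union> h ` t) ` h ` s = (`) h ` (\<lambda>x. (s - {x}) \<union> t) ` s"
    unfolding image_image image_Un image_set_diff[OF assms(1)] by simp
  ultimately show ?thesis
    unfolding flip_def by (simp add: image_Un)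
qed

lemma flippable_union:
  assumes "flippable F s t" "\<And>f. f \<in> R \<Longrightarrow> \<not> s \<subseteq> f \<and> \<not> t \<subseteq> f"
  shows "flippable (R \<union> F) s t"
proof -
  have "{f \<in> R \<union> F. s \<subseteq> f} = {f \<in> F. s \<subseteq> f}"
    using assms(2) by auto
  then show ?thesis
    using assms unfolding flippable_def by auto
qed

lemma flip_union:
  assumes "\<And>f. f \<in> R \<Longrightarrow> \<not> s \<subseteq> f"
  shows "flip (R \<union> F) s t = R \<union> flip F s t"
  using assms by (auto simp: flip_def)


section \<open>Checking sequences of flips\<close>

definition list_flip :: "'a list list \<Rightarrow> 'a list \<Rightarrow> 'a list \<Rightarrow> 'a list list" where
  "list_flip F s t = map (\<lambda>x. removeAll x s @ t) s @ filter (\<lambda>f. \<not> set s \<subseteq> set f) F"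

text \<open>Lists represent facets up to order, so the two families of facets are compared by
  matching in both directions up to \<open>set\<close>.\<close>

definition list_flippable :: "'a list list \<Rightarrow> 'a list \<Rightarrow> 'a list \<Rightarrow> bool" where
  "list_flippable F s t \<longleftrightarrow> s \<noteq> [] \<and> t \<noteq> [] \<and> distinct (s @ t) \<and>
     (let A = filter (\<lambda>f. set s \<subseteq> set f) F; A' = map (\<lambda>x. s @ removeAll x t) t in
        list_all (\<lambda>f. list_ex (\<lambda>g. set f = set g) A') A \<and>
        list_all (\<lambda>g. list_ex (\<lambda>f. set f = set g) A) A') \<and>
     list_all (\<lambda>f. \<not> set t \<subseteq> set f) F"

lemma flippable_set:
  assumes "list_flippable F s t"
  shows "flippable (set ` set F) (set s) (set t)"
proof -
  have "{f \<in> set ` set F. set s \<subseteq> f} = (\<lambda>x. set s \<union> (set t - {x})) ` set t"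
    using assms unfolding list_flippable_def Let_def list_all_iff list_ex_iff
    by (fastforce simp: image_iff)
  then show ?thesis
    using assms by (auto simp: list_flippable_def flippable_def list_all_iff)
qed

lemma flip_set: "set ` set (list_flip F s t) = flip (set ` set F) (set s) (set t)"
proof -
  have "set ` {f \<in> set F. \<not> set s \<subseteq> set f} = {f \<in> set ` set F. \<not> set s \<subseteq> f}"
    by auto
  then show ?thesis
    by (simp add: list_flip_def flip_def image_Un image_image Un_commute)
qed

text \<open>The side conditions on \<open>D\<close> make every flip fix the boundary of the simplex \<open>D\<close>, so that the
  sequence can be carried out inside a facet of a larger complex. Passing the property of the
  result as a predicate lets a single evaluation replay the flips and test the outcome.\<close>

fun check_flips ::
  "('a list list \<Rightarrow> bool) \<Rightarrow> 'a set \<Rightarrow> 'a list list \<Rightarrow> ('a list \<times> 'a list) list \<Rightarrow> bool"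
where
  "check_flips P D F [] = P F"
| "check_flips P D F ((s, t) # ps) = (length s + length t = 5 \<and> \<not> set s \<subset> D \<and> \<not> set t \<subset> D \<and>
     list_flippable F s t \<and> check_flips P D (list_flip F s t) ps)"

text \<open>\<open>R\<close> consists of the facets outside the ball and \<open>h\<close> renames
  the ball. Faces shared with \<open>R\<close> come from proper faces of \<open>D\<close>, whereas
  every flip exchanges faces that are not proper faces of \<open>D\<close>; so \<open>R\<close>
  stays untouched throughout.\<close>

lemma check_flips_inside:
  fixes h :: "'a \<Rightarrow> nat"
  assumes "check_flips P D F ps" and "inj h"
    and "finite R" "\<And>f. f \<in> R \<Longrightarrow> card f = 4"
    and "\<And>f s. f \<in> R \<Longrightarrow> h ` s \<subseteq> f \<Longrightarrow> s \<subset> D"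
    and "\<And>f. f \<in> set F \<Longrightarrow> card (set f) = 4"
  shows "\<exists>B. P B \<and> (\<forall>f\<in>set B. card (set f) = 4) \<and>
    PL_homeomorphic (generated_complex (R \<union> (`) h ` set ` set B))
      (generated_complex (R \<union> (`) h ` set ` set F))"
  using assms(1,6)
proof (induction ps arbitrary: F)
  case Nil
  then show ?case
    by (auto simp: PL_homeomorphic_def)
next
  case (Cons p ps)
  obtain s t where p: "p = (s, t)"
    by (cases p)
  let ?F = "(`) h ` set ` set F" and ?s = "h ` set s" and ?t = "h ` set t"
  have lf: "list_flippable F s t" and len: "length s + length t = 5"
    using Cons.prems(1) by (auto simp: p)
  have fl: "flippable ?F ?s ?t"
    by (rule flippable_image[OF assms(2) flippable_set[OF lf]])
  have away: "\<not> ?s \<subseteq> f \<and> \<not> ?t \<subseteq> f" if "f \<in> R" for f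
    using Cons.prems(1) assms(5)[OF that] by (auto simp: p)
  have flip_eq: "flip (R \<union> ?F) ?s ?t = R \<union> (`) h ` set ` set (list_flip F s t)"
    using flip_union[of R ?s ?F ?t] away by (simp add: flip_image[OF assms(2)] flip_set)
  have fin: "finite f" if "f \<in> R \<union> ?F" for f
    using that assms(4) by (auto intro: card_ge_0_finite)
  have "PL_homeomorphic (generated_complex (flip (R \<union> ?F) ?s ?t)) (generated_complex (R \<union> ?F))"
    by (rule PL_homeomorphic_flip[OF flippable_union[OF fl away]]) (use assms(3) fin in auto)
  then have step: "PL_homeomorphic (generated_complex (R \<union> (`) h ` set ` set (list_flip F s t)))
      (generated_complex (R \<union> ?F))"
    by (simp only: flip_eq)
  have "card (set f) = 4" if f: "f \<in> set (list_flip F s t)" for f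
  proof (cases "f \<in> set F")
    case True
    then show ?thesis
      using Cons.prems(2) by simp
  next
    case False
    then obtain x where "x \<in> set s" "f = removeAll x s @ t"
      using f by (auto simp: list_flip_def)
    moreover have "distinct (s @ t)"
      using lf by (simp add: list_flippable_def)
    \<comment> \<open>A new facet has one vertex fewer than \<open>s\<close> and \<open>t\<close>
      together, that is 5 - 1.\<close>
    ultimately have "distinct f" "length f = 4"
      using len by (auto simp: distinct_remove1_removeAll[symmetric] length_remove1 split: if_splits)
        (cases s, auto)
    then show ?thesis
      using distinct_card[of f] by simp
  qed
  moreover have "check_flips P D (list_flip F s t) ps"
    using Cons.prems(1) by (simp add: p)
  ultimately obtain B where "P B" "\<forall>f\<in>set B. card (set f) = 4"
    "PL_homeomorphic (generated_complex (R \<union> (`) h ` set ` set B))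
      (generated_complex (R \<union> (`) h ` set ` set (list_flip F s t)))"
    using Cons.IH by blast
  with step show ?case
    unfolding PL_homeomorphic_def by (meson rtranclp_trans)
qed


section \<open>Lower bounds for transversals\<close>

text \<open>A transversal contains some vertex of a shortest facet: branch on the first such vertex,
  deleting the earlier ones from all facets.\<close>

fun branch :: "('a list list \<Rightarrow> bool) \<Rightarrow> 'a list \<Rightarrow> 'a list list \<Rightarrow> bool" where
  "branch P [] fs = True"
| "branch P (x # xs) fs =
     (P (filter (\<lambda>f. x \<notin> set f) fs) \<and> branch P xs (map (removeAll x) fs))"

primrec transversals_exceed :: "nat \<Rightarrow> 'a list list \<Rightarrow> bool" where
  "transversals_exceed 0 fs = (fs \<noteq> [])"
| "transversals_exceed (Suc k) fs =
     (fs \<noteq> [] \<and> branch (transversals_exceed k) (arg_min_list length fs) fs)"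

text \<open>If \<open>x\<close> is in \<open>T\<close>, then \<open>T - {x}\<close> still meets all
  facets without \<open>x\<close>; otherwise deleting \<open>x\<close> from the facets loses no
  intersection with \<open>T\<close>. On the empty list the assumption on \<open>xs\<close> fails,
  which justifies the value \<open>True\<close> of \<open>branch\<close> there.\<close>

lemma branch_sound:
  assumes "branch P xs fs" and "finite T" "T \<inter> set xs \<noteq> {}" "\<And>f. f \<in> set fs \<Longrightarrow> T \<inter> set f \<noteq> {}"
    and "\<And>fs T. P fs \<Longrightarrow> finite T \<Longrightarrow> \<forall>f\<in>set fs. T \<inter> set f \<noteq> {} \<Longrightarrow> k < card T"
  shows "Suc k < card T"
  using assms(1,3,4)
proof (induction xs arbitrary: fs)
  case (Cons x xs)
  show ?case
  proof (cases "x \<in> T")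
    case True
    have "\<forall>f\<in>set (filter (\<lambda>f. x \<notin> set f) fs). (T - {x}) \<inter> set f \<noteq> {}"
      using Cons.prems(3) by fastforce
    then have "k < card (T - {x})"
      using assms(5)[of "filter (\<lambda>f. x \<notin> set f) fs" "T - {x}"] Cons.prems(1) \<open>finite T\<close> by simp
    then show ?thesis
      using True \<open>finite T\<close> by (simp add: card_Diff_singleton)
  next
    case False
    then have "T \<inter> set f \<noteq> {}" if "f \<in> set (map (removeAll x) fs)" for f
      using that Cons.prems(3) by fastforce
    moreover have "T \<inter> set xs \<noteq> {}"
      using Cons.prems(2) False by auto
    ultimately show ?thesis
      using Cons.IH[of "map (removeAll x) fs"] Cons.prems(1) by auto
  qed
qed simp

lemma transversals_exceed_sound:
  assumes "transversals_exceed k fs" "finite T" "\<forall>f\<in>set fs. T \<inter> set f \<noteq> {}"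
  shows "k < card T"
  using assms
proof (induction k arbitrary: fs T)
  case 0
  then have "T \<noteq> {}"
    by (cases fs) auto
  then show ?case
    using 0 by (simp add: card_gt_0_iff)
next
  case (Suc k)
  then have "arg_min_list length fs \<in> set fs"
    by (simp add: arg_min_list_in)
  then show ?case
    using Suc by (intro branch_sound[of "transversals_exceed k" "arg_min_list length fs" fs]) auto
qed


section \<open>The block\<close>

text \<open>The boundary tetrahedron has vertices 0, 1, 2, 3 and the interior vertices are 4 to 20. The
  facets spanned by the interior vertices are those of a 17-vertex sphere minus \<open>{4, 5, 6, 7}\<close>; this
  sphere was found by simulated annealing over flips, minimising the number of 9-element vertex
  sets that contain no facet. Replaying a flip simplification of the ball backwards gives the list.\<close>

definition block_flips :: "(nat list \<times> nat list) list" where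
  "block_flips = [
    ([0, 1, 2, 3], [4]), ([0, 1, 2, 4], [5]), ([0, 1, 4, 5], [6]), ([0, 4, 5, 6], [7]),
    ([4, 5, 6, 7], [8]), ([4, 5, 6, 8], [9]), ([4, 6, 8, 9], [10]), ([4, 6, 8, 10], [11]),
    ([4, 6, 8], [7, 11]), ([4, 8, 10, 11], [12]), ([4, 8, 11], [7, 12]), ([4, 8, 10], [9, 12]),
    ([4, 8, 9], [5, 12]), ([6, 7, 8, 11], [13]), ([7, 8, 11], [12, 13]), ([4, 7, 8, 12], [14]),
    ([7, 8, 12], [13, 14]), ([8, 12, 13, 14], [15]), ([8, 12, 14], [4, 15]),
    ([4, 8, 12], [5, 15]), ([8, 12, 15], [5, 13]), ([5, 6, 8], [7, 9]), ([6, 7, 8], [9, 13]),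
    ([4, 6, 9], [5, 10]), ([7, 8, 13], [9, 14]), ([8, 13, 14], [9, 15]), ([5, 6, 9], [7, 10]),
    ([8, 9, 13], [6, 15]), ([6, 7, 9], [10, 13]), ([6, 9, 13], [10, 15]), ([6, 10, 13], [7, 15]),
    ([6, 8, 10], [9, 11]), ([5, 7, 9, 10], [16]), ([7, 9, 10], [13, 16]),
    ([9, 10, 13], [15, 16]), ([9, 10, 15], [6, 16]), ([6, 9, 10], [11, 16]),
    ([6, 10, 11], [4, 16]), ([7, 10, 13, 15], [17]), ([7, 13, 15], [6, 17]),
    ([10, 13, 15], [16, 17]), ([6, 8, 13, 15], [18]), ([6, 13, 15], [17, 18]),
    ([13, 15, 17], [16, 18]), ([13, 15, 18], [8, 16]), ([4, 10, 11], [12, 16]),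
    ([6, 9, 16], [11, 15]), ([8, 12, 13], [5, 11]), ([4, 6, 10, 16], [19]),
    ([4, 10, 16], [12, 19]), ([4, 10, 12], [9, 19]), ([4, 6, 16, 19], [20]),
    ([4, 6, 16], [11, 20]), ([4, 16, 19], [12, 20]), ([4, 6, 11], [7, 20]),
    ([4, 12, 19], [9, 20]), ([6, 7, 11], [13, 20]), ([4, 9, 12], [5, 20]),
    ([6, 11, 13], [8, 20]), ([4, 5, 9], [10, 20]), ([4, 5, 12], [15, 20]),
    ([4, 12, 15], [14, 20]), ([4, 15, 20], [5, 14]), ([6, 8, 15], [9, 18]),
    ([8, 9, 15], [14, 18]), ([6, 8, 9], [11, 18]), ([8, 9, 18], [11, 14]),
    ([4, 5, 20], [10, 14]), ([4, 5, 10], [6, 14]), ([7, 9, 13], [14, 16]),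
    ([4, 6, 10], [14, 19]), ([6, 16, 20], [11, 19]), ([6, 11, 20], [8, 19]),
    ([6, 11, 16], [15, 19]), ([6, 10, 14], [5, 19]), ([5, 6, 10], [7, 19]),
    ([8, 11, 20], [13, 19]), ([6, 7, 13], [17, 20]), ([6, 7, 20], [4, 17]),
    ([4, 6, 20], [17, 19]), ([4, 6, 19], [14, 17]), ([6, 15, 18], [9, 17]),
    ([6, 14, 19], [5, 17]), ([4, 7, 20], [11, 17]), ([4, 7, 11], [12, 17]),
    ([10, 16, 19], [6, 12]), ([5, 8, 15], [4, 13]), ([6, 8, 13], [18, 20]),
    ([8, 14, 15], [4, 18]), ([4, 8, 14], [7, 18]), ([4, 7, 14], [12, 18]),
    ([6, 8, 11], [18, 19]), ([4, 7, 8], [5, 18]), ([6, 19, 20], [8, 17])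
  ]"

text \<open>Labels from 4 on are interior, and exceeding 8 means at least 9. The second condition
  supplies a facet touching the boundary, to be replaced next; the third fixes the vertex
  count.\<close>

definition is_block :: "nat list list \<Rightarrow> bool" where
  "is_block B \<longleftrightarrow> transversals_exceed 8 (filter (list_all (\<lambda>x. 4 \<le> x)) B) \<and>
     list_ex (\<lambda>f. \<not> list_all (\<lambda>x. 4 \<le> x) f) B \<and>
     set (concat B) = {0..<21}"

lemma check_block_flips: "check_flips is_block {0, 1, 2, 3} [[0, 1, 2, 3]] block_flips"
  by code_simp


section \<open>Inserting blocks\<close>

text \<open>Here \<open>g\<close> is a facet that the lower bound \<open>k\<close> does not depend on, so that it may be replaced by
  a further block.\<close>

definition sphere_needing :: "nat set set \<Rightarrow> nat set \<Rightarrow> nat \<Rightarrow> bool" where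
  "sphere_needing F g k \<longleftrightarrow> finite F \<and> (\<forall>f\<in>F. card f = 4) \<and> g \<in> F \<and>
     PL_sphere 3 (generated_complex F) \<and>
     (\<forall>T. finite T \<longrightarrow> (\<forall>f\<in>F - {g}. T \<inter> f \<noteq> {}) \<longrightarrow> k \<le> card T)"

text \<open>The facets other than \<open>g\<close> survive and force \<open>k\<close> old vertices
  into a transversal; the interior facets of the block force 9 new ones. The new spare facet
  \<open>g'\<close> is of neither kind.\<close>

lemma insert_block:
  assumes "sphere_needing F g k"
  shows "\<exists>F' g'. sphere_needing F' g' (k + 9) \<and> card (\<Union>F') = card (\<Union>F) + 17"
proof -
  have "finite F" and card4: "\<And>f. f \<in> F \<Longrightarrow> card f = 4" and "g \<in> F"
    and sphere: "PL_sphere 3 (generated_complex F)"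
    and bound: "\<And>T. finite T \<Longrightarrow> \<forall>f\<in>F - {g}. T \<inter> f \<noteq> {} \<Longrightarrow> k \<le> card T"
    using assms by (auto simp: sphere_needing_def)
  have fin: "finite f" if "f \<in> F" for f
    using card4[OF that] by (auto intro: card_ge_0_finite)
  obtain e where e: "bij_betw e {0..<4::nat} g"
    using ex_bij_betw_nat_finite[OF fin[OF \<open>g \<in> F\<close>]] card4[OF \<open>g \<in> F\<close>] by auto
  have finU: "finite (\<Union>F)"
    using \<open>finite F\<close> fin by auto
  then obtain M where M: "\<And>x. x \<in> \<Union>F \<Longrightarrow> x < M"
    by (meson finite_nat_set_iff_bounded)
  \<comment> \<open>The boundary labels go to the vertices of \<open>g\<close>, the interior ones
    beyond all old vertices.\<close>
  define h where "h x = (if x < 4 then e x else M + x)" for x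
  have e_g: "e x \<in> g" if "x < 4" for x
    using e that by (auto simp: bij_betw_def)
  have e_M: "e x < M" if "x < 4" for x
    using e_g[OF that] M \<open>g \<in> F\<close> by auto
  have "inj h"
  proof (rule injI)
    fix x y assume eq: "h x = h y"
    then have "x < 4 \<longleftrightarrow> y < 4"
      using e_M[of x] e_M[of y] by (auto simp: h_def split: if_splits)
    then show "x = y"
      using eq e by (auto simp: h_def bij_betw_def inj_on_def split: if_splits)
  qed
  have "h ` {0..<4} = e ` {0..<4}"
    by (auto simp: h_def)
  then have hg: "h ` {0..<4} = g"
    using e by (simp add: bij_betw_def)
  have four: "{0, 1, 2, 3} = {0..<4::nat}"
    by auto
  define R where "R = F - {g}"
  have R: "finite R" "\<And>f. f \<in> R \<Longrightarrow> card f = 4"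
    using \<open>finite F\<close> card4 by (auto simp: R_def)
  \<comment> \<open>An old facet has no vertex from \<open>M\<close> on, and containing all of
    \<open>g\<close> would make it equal to \<open>g\<close>.\<close>
  have away: "s \<subset> {0..<4}" if f: "f \<in> R" and sub: "h ` s \<subseteq> f" for f s
  proof -
    have "x < 4" if "x \<in> s" for x
    proof (rule ccontr)
      assume "\<not> x < 4"
      moreover have "h x < M"
        using that f sub M by (auto simp: R_def)
      ultimately show False
        by (simp add: h_def)
    qed
    then have "s \<subseteq> {0..<4}"
      by auto
    moreover have "s \<noteq> {0..<4}"
    proof
      assume "s = {0..<4}"
      then have "g \<subseteq> f"
        using sub hg by simp
      then have "g = f"
        using f fin card4 \<open>g \<in> F\<close> by (metis R_def DiffD1 card_subset_eq)
      then show False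
        using f by (simp add: R_def)
    qed
    ultimately show ?thesis
      by auto
  qed
  have "\<exists>B. is_block B \<and> (\<forall>f\<in>set B. card (set f) = 4) \<and>
    PL_homeomorphic (generated_complex (R \<union> (`) h ` set ` set B))
      (generated_complex (R \<union> (`) h ` set ` set [[0, 1, 2, 3]]))"
    by (rule check_flips_inside[OF check_block_flips \<open>inj h\<close> R]) (use away four in auto)
  moreover have "set ` set [[0, 1, 2, 3::nat]] = {{0..<4}}"
    using four by simp
  moreover have "R \<union> (`) h ` {{0..<4}} = F"
    using hg \<open>g \<in> F\<close> by (auto simp: R_def)
  ultimately obtain B where B: "is_block B" and B4: "\<And>f. f \<in> set B \<Longrightarrow> card (set f) = 4"
    and PL: "PL_homeomorphic (generated_complex (R \<union> (`) h ` set ` set B)) (generated_complex F)"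
    by metis
  define F' where "F' = R \<union> (`) h ` set ` set B"
  have F'_card: "card f = 4" if "f \<in> F'" for f
    using that R(2) B4 card_image[OF inj_on_subset[OF \<open>inj h\<close> subset_UNIV]] by (auto simp: F'_def)
  have "finite F'"
    using R(1) by (simp add: F'_def)
  obtain f0 x0 where f0: "f0 \<in> set B" "x0 \<in> set f0" "x0 < 4"
    using B by (auto simp: is_block_def list_ex_iff list_all_iff not_le)
  define g' where "g' = h ` set f0"
  have "g' \<in> F'"
    using f0 by (simp add: F'_def g'_def)
  have "simplicial_complex (generated_complex F')"
    using \<open>finite F'\<close> \<open>g' \<in> F'\<close> F'_card
    by (intro simplicial_complex_generated) (auto intro: card_ge_0_finite)
  then have sphere': "PL_sphere 3 (generated_complex F')"
    using PL sphere unfolding PL_sphere_def PL_homeomorphic_def F'_def by (meson rtranclp_trans)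
  have bound': "k + 9 \<le> card T" if "finite T" and T: "\<forall>f\<in>F' - {g'}. T \<inter> f \<noteq> {}" for T
  proof -
    \<comment> \<open>\<open>T1\<close> is the part of \<open>T\<close> on old vertices;
      \<open>T2\<close> holds the labels of its new ones.\<close>
    define T1 T2 where "T1 = T \<inter> {..<M}" and "T2 = {x. 4 \<le> x \<and> h x \<in> T}"
    have "T1 \<inter> f \<noteq> {}" if f: "f \<in> R" for f
    proof -
      \<comment> \<open>\<open>T\<close> need not meet \<open>g'\<close>, so \<open>g'\<close> must
        be kept out of \<open>R\<close>: it has four vertices and cannot be the image of a proper
        face of the tetrahedron.\<close>
      have "f \<noteq> g'"
      proof
        assume "f = g'"
        then have "set f0 \<subset> {0..<4}"
          using away[OF f, of "set f0"] by (simp add: g'_def)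
        then have "card (set f0) < 4"
          using psubset_card_mono[of "{0..<4::nat}" "set f0"] by simp
        then show False
          using B4[OF f0(1)] by simp
      qed
      then have "T \<inter> f \<noteq> {}"
        using T f by (auto simp: F'_def)
      then show ?thesis
        using M f by (auto simp: T1_def R_def)
    qed
    then have T1: "k \<le> card T1"
      using bound[of T1] \<open>finite T\<close> by (auto simp: T1_def R_def)
    have h_T2: "h ` T2 \<subseteq> T - T1"
      by (auto simp: T1_def T2_def h_def)
    have inj2: "inj_on h T2"
      using \<open>inj h\<close> by (rule inj_on_subset) simp
    have fin2: "finite T2"
      using h_T2 inj2 \<open>finite T\<close> by (meson finite_Diff finite_imageD finite_subset)
    have "T2 \<inter> set f \<noteq> {}" if "f \<in> set (filter (list_all (\<lambda>x. 4 \<le> x)) B)" for f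
    proof -
      have f: "f \<in> set B" "\<forall>x\<in>set f. 4 \<le> x"
        using that by (auto simp: list_all_iff)
      \<comment> \<open>\<open>f0\<close> has a boundary vertex, so the interior bound does not
        depend on it.\<close>
      then have "set f \<noteq> set f0"
        using f0 by (metis not_le)
      then have "h ` set f \<noteq> g'"
        using \<open>inj h\<close> by (simp add: g'_def inj_image_eq_iff)
      then have "T \<inter> h ` set f \<noteq> {}"
        using T f(1) by (auto simp: F'_def)
      then show ?thesis
        using f(2) by (auto simp: T2_def)
    qed
    then have "8 < card T2"
      using B fin2 by (intro transversals_exceed_sound) (auto simp: is_block_def)
    also have "card T2 \<le> card (T - T1)"
      using h_T2 inj2 \<open>finite T\<close> by (metis card_image card_mono finite_Diff)
    also have "\<dots> = card T - card T1"
      using \<open>finite T\<close> by (intro card_Diff_subset) (auto simp: T1_def)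
    finally show ?thesis
      using T1 by simp
  qed
  have "\<Union>(set ` set B) = {0..<21}"
    using B by (simp add: is_block_def)
  then have "\<Union>F' = \<Union>R \<union> h ` {0..<21}"
    unfolding F'_def by (metis Union_Un_distrib image_Union)
  also have "{0..<21} = {0..<4} \<union> {4..<21::nat}"
    by auto
  also have "\<Union>R \<union> h ` ({0..<4} \<union> {4..<21}) = \<Union>F \<union> h ` {4..<21}"
    using hg \<open>g \<in> F\<close> by (auto simp: R_def image_Un)
  finally have U: "\<Union>F' = \<Union>F \<union> h ` {4..<21}" .
  have "\<Union>F \<inter> h ` {4..<21} = {}"
    using M by (force simp: h_def)
  moreover have "card (h ` {4..<21}) = 17"
    using card_image[OF inj_on_subset[OF \<open>inj h\<close> subset_UNIV], of "{4..<21}"] by simp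
  ultimately have "card (\<Union>F') = card (\<Union>F) + 17"
    using finU U by (simp add: card_Un_disjoint)
  moreover have "sphere_needing F' g' (k + 9)"
    unfolding sphere_needing_def using \<open>finite F'\<close> F'_card \<open>g' \<in> F'\<close> sphere' bound' by blast
  ultimately show ?thesis
    by blast
qed

lemma sphere_of_blocks: "\<exists>F g. sphere_needing F g (9 * m) \<and> card (\<Union>F) = 5 + 17 * m"
proof (induction m)
  case 0
  let ?S = "{0..<5::nat}"
  define F where "F = (\<lambda>x. ?S - {x}) ` ?S"
  have eq: "generated_complex F = simplex_boundary ?S"
    unfolding generated_complex_def simplex_boundary_def F_def by blast
  have F: "finite F" "\<forall>f\<in>F. card f = 4" "?S - {0} \<in> F"
    by (auto simp: F_def)
  have "simplicial_complex (generated_complex F)"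
    using F by (intro simplicial_complex_generated) (auto simp: F_def)
  then have "PL_sphere 3 (generated_complex F)"
    unfolding PL_sphere_def PL_homeomorphic_def eq by (intro conjI exI[of _ ?S]) auto
  moreover have "\<Union>F = ?S"
  proof
    show "?S \<subseteq> \<Union>F"
    proof
      fix x assume "x \<in> ?S"
      \<comment> \<open>Every vertex lies on the facet opposite to some other vertex.\<close>
      then have "x \<in> ?S - {if x = 0 then 1 else 0}" "(if x = 0 then 1 else 0) \<in> ?S"
        by auto
      then show "x \<in> \<Union>F"
        unfolding F_def by blast
    qed
  qed (auto simp: F_def)
  ultimately have "sphere_needing F (?S - {0}) (9 * 0)" "card (\<Union>F) = 5 + 17 * 0"
    using F by (simp_all add: sphere_needing_def)
  then show ?case
    by blast
next
  case (Suc m)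
  then obtain F g where F: "sphere_needing F g (9 * m)" "card (\<Union>F) = 5 + 17 * m"
    by blast
  obtain F' g' where "sphere_needing F' g' (9 * m + 9)" "card (\<Union>F') = card (\<Union>F) + 17"
    using insert_block[OF F(1)] by blast
  then have "sphere_needing F' g' (9 * Suc m)" "card (\<Union>F') = 5 + 17 * Suc m"
    using F(2) by (simp_all add: add.commute)
  then show ?case
    by blast
qed

theorem theorem1p3:
  fixes N :: int
  shows "\<exists>K :: nat set set. PL_sphere 3 K \<and> int (card (vertices K)) \<ge> N \<and>
           real (tau_facets K) \<ge> 11 / 21 * real (card (vertices K))"
proof -
  \<comment> \<open>The inequality \<open>11 * (5 + 17 * m) \<le> 21 * 9 * m\<close> amounts to
    \<open>55 \<le> 2 * m\<close>, hence 28; the summand \<open>nat N\<close> makes the vertex count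
    reach \<open>N\<close>.\<close>
  define m where "m = nat N + 28"
  obtain F g where needing: "sphere_needing F g (9 * m)" and card: "card (\<Union>F) = 5 + 17 * m"
    using sphere_of_blocks[of m] by blast
  have F: "finite F" "\<And>f. f \<in> F \<Longrightarrow> card f = 4"
    and sphere: "PL_sphere 3 (generated_complex F)"
    and bound: "\<And>T. finite T \<Longrightarrow> \<forall>f\<in>F - {g}. T \<inter> f \<noteq> {} \<Longrightarrow> 9 * m \<le> card T"
    using needing unfolding sphere_needing_def by blast+
  have fin: "finite f" if "f \<in> F" for f
    using F(2)[OF that] by (auto intro: card_ge_0_finite)
  have facets: "facets (generated_complex F) = F"
    using F(2) fin by (intro facets_generated[of F 4]) auto
  have "finite (\<Union>F)"
    using F(1) fin by auto
  \<comment> \<open>The full vertex set is a transversal, so the minimum in the transversal number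
    is attained.\<close>
  have "\<Union>F \<inter> f \<noteq> {}" if "f \<in> F" for f
    using F(2)[OF that] by (simp add: Int_absorb1 Union_upper[OF that]) auto
  then have "transversal (\<Union>F) F (\<Union>F)"
    by (simp add: transversal_def)
  then have "\<exists>T. transversal (\<Union>F) F T \<and> card T = tau_facets (generated_complex F)"
    unfolding tau_facets_def transversal_number_def vertices_generated facets
    by (rule LeastI_ex[of "\<lambda>k. \<exists>T. transversal (\<Union>F) F T \<and> card T = k", OF exI, OF exI, OF conjI])
      simp
  then obtain T where T: "transversal (\<Union>F) F T" "card T = tau_facets (generated_complex F)"
    by auto
  have "finite T"
    using T(1) finite_subset[OF _ \<open>finite (\<Union>F)\<close>] by (simp add: transversal_def)
  then have "9 * m \<le> tau_facets (generated_complex F)"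
    using bound[of T] T by (simp add: transversal_def)
  then have "real (9 * m) \<le> real (tau_facets (generated_complex F))"
    by (simp only: of_nat_le_iff)
  moreover have "11 / 21 * real (5 + 17 * m) \<le> real (9 * m)" and "N \<le> int (5 + 17 * m)"
    by (simp_all add: m_def)
  ultimately show ?thesis
    using sphere card by (intro exI[of _ "generated_complex F"]) (simp add: vertices_generated)
qed

end
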